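(* Let $q$ be a prime power and let $\overline{\mathbb{F}_q}$ be an algebraic closure of the finite field $\mathbb{F}_q$. Let $A$ and $B$ be $\mathbb{F}_q$-subspaces of $\overline{\mathbb{F}_q}$ of size $q^d$ and $q^{d'}$, respectively. Suppose that $A$ does not contain any nonzero $\mathbb{F}_{q^e}$-subspace of $\overline{\mathbb{F}_q}$ with $e>1$. Then $$\frac{|A^{-1}\cap B|}{q-1}\le m_d(d'-1,q).$$
   Context: For an $\mathbb{F}_q$-subspace $A$ of $\overline{\mathbb{F}_q}$, $A^{-1}=\{x^{-1}: 0\neq x\in A\}$ is the set of inverses of the nonzero elements of $A$. For a positive integer $e$, $\mathbb{F}_{q^e}$ denotes the subfield of $\overline{\mathbb{F}_q}$ with $q^e$ elements. $PG(n,q)$ denotes the $n$-dimensional projective space over $\mathbb{F}_q$, i.e. the projective space of an $(n+1)$-dimensional $\mathbb{F}_q$-vector space. A $(k,r)$-cap in $PG(n,q)$ is a set of $k$ points, of which no $r+1$ are collinear, i.e. such that no (projective) line contains more than $r$ of them. The largest size $k$ of a $(k,r)$-cap in $PG(n,q)$ is denoted by $m_r(n,q)$. *)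

theory Defs
  imports
    "HOL-Algebra.Algebraic_Closure"
    "HOL-Number_Theory.Prime_Powers"
    "HOL-Library.FuncSet"
begin

text \<open>
  Coordinate model of the projective space over a field \<open>F\<close>: the vector space \<open>F\<^sup>m\<close> consists of the
  extensional functions from \<open>{..<m}\<close> to the carrier of \<open>F\<close>. Points and lines of \<open>PG(n,F)\<close> are the
  1- and 2-dimensional subspaces of the coordinate space of dimension \<open>n + 1\<close>, and incidence is inclusion.
\<close>

definition coord_space :: "('a, 'b) ring_scheme \<Rightarrow> nat \<Rightarrow> (nat \<Rightarrow> 'a) set" where
  "coord_space F m = {..<m} \<rightarrow>\<^sub>E carrier F"

definition nonzero_vecs :: "('a, 'b) ring_scheme \<Rightarrow> nat \<Rightarrow> (nat \<Rightarrow> 'a) set" where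
  "nonzero_vecs F m = coord_space F m - {\<lambda>i\<in>{..<m}. \<zero>\<^bsub>F\<^esub>}"

definition span1 :: "('a, 'b) ring_scheme \<Rightarrow> nat \<Rightarrow> (nat \<Rightarrow> 'a) \<Rightarrow> (nat \<Rightarrow> 'a) set" where
  "span1 F m u = {\<lambda>i\<in>{..<m}. a \<otimes>\<^bsub>F\<^esub> u i | a. a \<in> carrier F}"

definition span2 ::
  "('a, 'b) ring_scheme \<Rightarrow> nat \<Rightarrow> (nat \<Rightarrow> 'a) \<Rightarrow> (nat \<Rightarrow> 'a) \<Rightarrow> (nat \<Rightarrow> 'a) set" where
  "span2 F m u v = {\<lambda>i\<in>{..<m}. a \<otimes>\<^bsub>F\<^esub> u i \<oplus>\<^bsub>F\<^esub> b \<otimes>\<^bsub>F\<^esub> v i | a b. a \<in> carrier F \<and> b \<in> carrier F}"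

definition PG_points :: "('a, 'b) ring_scheme \<Rightarrow> nat \<Rightarrow> (nat \<Rightarrow> 'a) set set" where
  "PG_points F n = {span1 F (n + 1) u | u. u \<in> nonzero_vecs F (n + 1)}"

text \<open>Two nonzero vectors are linearly independent iff they span different points.\<close>

definition PG_lines :: "('a, 'b) ring_scheme \<Rightarrow> nat \<Rightarrow> (nat \<Rightarrow> 'a) set set" where
  "PG_lines F n = {span2 F (n + 1) u v | u v. u \<in> nonzero_vecs F (n + 1) \<and>
     v \<in> nonzero_vecs F (n + 1) \<and> span1 F (n + 1) u \<noteq> span1 F (n + 1) v}"

definition is_cap ::
  "('a, 'b) ring_scheme \<Rightarrow> nat \<Rightarrow> nat \<Rightarrow> nat \<Rightarrow> (nat \<Rightarrow> 'a) set set \<Rightarrow> bool" where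
  "is_cap F n k r S \<longleftrightarrow> S \<subseteq> PG_points F n \<and> finite S \<and> card S = k \<and>
     (\<forall>l\<in>PG_lines F n. card {P \<in> S. P \<subseteq> l} \<le> r)"

text \<open>
  \<open>max_cap r n F\<close> is \<open>m\<^sub>r(n,q)\<close>, where the order \<open>q\<close> enters through the finite field \<open>F\<close> with \<open>q\<close>
  elements, which is unique up to isomorphism.
\<close>

definition max_cap :: "nat \<Rightarrow> nat \<Rightarrow> ('a, 'b) ring_scheme \<Rightarrow> nat" where
  "max_cap r n F = Max {k. \<exists>S. is_cap F n k r S}"

definition inverse_set :: "('a, 'b) ring_scheme \<Rightarrow> 'a set \<Rightarrow> 'a set" where
  "inverse_set L A = {inv\<^bsub>L\<^esub> x | x. x \<in> A \<and> x \<noteq> \<zero>\<^bsub>L\<^esub>}"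

end

theory Submission
  imports Defs
begin

text \<open>
  After identifying \<open>B\<close> with the coordinate space, the points represented by elements of
  \<open>A\<^sup>-\<^sup>1 \<inter> B\<close> form a \<open>d\<close>-cap. Suppose \<open>d + 1\<close> pairwise non-proportional elements \<open>w\<close> of
  a 2-dimensional space have their inverses in \<open>A\<close>. By dimension, some \<open>1 / w\<^sub>0\<close> lies in the span
  \<open>V\<close> of the inverses of other ones. Fix such another element \<open>w\<^sub>1\<close>. Every \<open>w\<close> is a
  combination of \<open>w\<^sub>0\<close> and \<open>w\<^sub>1\<close>, whence \<open>V\<close> is closed under multiplication by
  \<open>x = w\<^sub>1 / w\<^sub>0 \<notin> K\<close>. The stabilizer \<open>{y. y V \<subseteq> V}\<close> is then a finite field properly
  containing \<open>K\<close>, and \<open>V \<subseteq> A\<close> is a nonzero space over it, a contradiction.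
\<close>

section \<open>Linear algebra over a finite subfield, by counting\<close>

context ring
begin

lemma card_subfield_gt_1:
  assumes "subfield K R" "finite K"
  shows "card K > 1"
proof -
  have "{\<zero>, \<one>} \<subseteq> K" "\<one> \<noteq> \<zero>"
    using subringE(2,3)[OF subfieldE(1)[OF assms(1)]] subfieldE(6)[OF assms(1)] by auto
  then show ?thesis
    using card_mono[OF assms(2), of "{\<zero>, \<one>}"] by auto
qed

lemma finite_Span:
  assumes "subfield K R" "finite K" "set Us \<subseteq> carrier R"
  shows "finite (Span K Us)"
proof -
  have "Span K Us = (\<lambda>Ks. combine Ks Us) ` {Ks. set Ks \<subseteq> K \<and> length Ks = length Us}"
    unfolding Span_eq_combine_set_length_version[OF assms(1,3)] by blast
  then show ?thesis
    using finite_lists_length_eq[OF assms(2)] by auto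
qed

text \<open>Coefficient lists map onto the span. The bound serves the vector plane over a projective
  line.\<close>

lemma card_Span_le:
  assumes "subfield K R" "finite K" "set Us \<subseteq> carrier R"
  shows "card (Span K Us) \<le> card K ^ length Us"
proof -
  have "Span K Us = (\<lambda>Ks. combine Ks Us) ` {Ks. set Ks \<subseteq> K \<and> length Ks = length Us}"
    unfolding Span_eq_combine_set_length_version[OF assms(1,3)] by blast
  then have "card (Span K Us) \<le> card {Ks. set Ks \<subseteq> K \<and> length Ks = length Us}"
    by (simp only: card_image_le finite_lists_length_eq[OF assms(2)])
  then show ?thesis
    by (simp only: card_lists_length_eq[OF assms(2)])
qed

text \<open>Independence makes the coefficient list of each vector unique, so \<open>combine\<close>
  maps coefficient lists bijectively onto the span.\<close>

lemma card_Span_independent: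
  assumes "subfield K R" "finite K" "independent K Us"
  shows "card (Span K Us) = card K ^ length Us"
proof -
  have Us: "set Us \<subseteq> carrier R"
    using independent_in_carrier[OF assms(3)] .
  let ?D = "{Ks. set Ks \<subseteq> K \<and> length Ks = length Us}"
  have img: "Span K Us = (\<lambda>Ks. combine Ks Us) ` ?D"
    unfolding Span_eq_combine_set_length_version[OF assms(1) Us] by blast
  have "inj_on (\<lambda>Ks. combine Ks Us) ?D"
    using unique_decomposition[OF assms(1,3)] img by (intro inj_onI) blast
  then have "card (Span K Us) = card ?D"
    unfolding img by (rule card_image)
  then show ?thesis
    by (simp only: card_lists_length_eq[OF assms(2)])
qed

text \<open>\<open>subalgebra K V R\<close> asks only for an additive subgroup closed under scalars
  from \<open>K\<close>, so it means a subspace. A list of all its elements generates it, so it has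
  a finite basis.\<close>

lemma finite_subalgebra_base:
  assumes K: "subfield K R" "finite K" and V: "subalgebra K V R" "finite V"
  obtains Us where "independent K Us" "Span K Us = V" "card V = card K ^ length Us"
proof -
  obtain vs where vs: "set vs = V"
    using finite_list[OF V(2)] by (elim exE)
  have carr: "set vs \<subseteq> carrier R"
    using subalgebra_in_carrier[OF V(1)] vs by simp
  have "Span K vs = V"
    using subalgebra_Span_incl[OF K(1) V(1)] Span_base_incl[OF K(1) carr] unfolding vs
    by (intro equalityI) (simp_all only: vs order_refl)
  then obtain n where "dimension n K V"
    using Span_finite_dimension[OF K(1) carr] unfolding finite_dimension_def by metis
  from exists_base[OF K(1) this]
  obtain Us where Us: "independent K Us" "Span K Us = V"
    by (elim exE conjE)
  show thesis
    using that[OF Us] card_Span_independent[OF K Us(1)] unfolding Us(2) .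
qed

text \<open>Either the head lies in the span of the tail, or the tail is itself dependent.
  Expressing \<open>u\<close> through later entries only keeps its position out of the list
  \<open>ys\<close>, which will span the space \<open>V\<close> of the main argument.\<close>

lemma dependent_split:
  assumes "set Us \<subseteq> carrier R" "dependent K Us"
  obtains xs u ys where "Us = xs @ u # ys" "u \<in> Span K ys"
proof -
  have "\<exists>xs u ys. Us = xs @ u # ys \<and> u \<in> Span K ys"
    using assms
  proof (induction Us)
    case (Cons v Us)
    show ?case
    proof (cases "v \<in> Span K Us")
      case True
      then show ?thesis by (metis append_Nil)
    next
      case False
      then have "dependent K Us"
        using Cons.prems li_Cons by auto
      then show ?thesis
        using Cons by (metis append_Cons insert_subset list.simps(15))
    qed
  qed auto
  then show thesis
    using that by blast
qed

lemma Span_pair: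
  assumes K: "subfield K R" and "x \<in> carrier R" "y \<in> carrier R"
  shows "Span K [x, y] = {a \<otimes> x \<oplus> b \<otimes> y | a b. a \<in> K \<and> b \<in> K}"
proof -
  have "b \<otimes> y \<oplus> \<zero> = b \<otimes> y" if "b \<in> K" for b
    using assms(3) subfieldE(3)[OF K] that by (auto simp: subset_iff)
  moreover have "z \<in> Span K [x, y] \<longleftrightarrow> (\<exists>a\<in>K. \<exists>b\<in>K. z = a \<otimes> x \<oplus> (b \<otimes> y \<oplus> \<zero>))" for z
    by (simp add: line_extension_mem_iff Bex_def) blast
  ultimately have "z \<in> Span K [x, y] \<longleftrightarrow> (\<exists>a\<in>K. \<exists>b\<in>K. z = a \<otimes> x \<oplus> b \<otimes> y)" for z
    by simp
  then show ?thesis by blast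
qed

text \<open>\<open>\<phi>\<close> reads a function as the coefficients over a basis of
  \<open>B\<close>. Linearity is one rule with two scalars because its left side then has the shape
  of the elements of \<open>span2\<close>.\<close>

lemma subalgebra_coordinates:
  assumes K: "subfield K R" "finite K" and B: "subalgebra K B R" "card B = card K ^ m"
  obtains \<phi> where "bij_betw \<phi> ({..<m} \<rightarrow>\<^sub>E K) B"
    and "\<And>a b f g. \<lbrakk>a \<in> K; b \<in> K; f \<in> {..<m} \<rightarrow>\<^sub>E K; g \<in> {..<m} \<rightarrow>\<^sub>E K\<rbrakk> \<Longrightarrow>
      \<phi> (\<lambda>i\<in>{..<m}. a \<otimes> f i \<oplus> b \<otimes> g i) = a \<otimes> \<phi> f \<oplus> b \<otimes> \<phi> g"
proof -
  have Kc: "K \<subseteq> carrier R"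
    using subfieldE(3)[OF K(1)] .
  have "card K > 1"
    using card_subfield_gt_1[OF K] .
  then have "finite B"
    using B(2) by (intro card_ge_0_finite) auto
  then obtain Us where Us: "independent K Us" "Span K Us = B" "card B = card K ^ length Us"
    using finite_subalgebra_base[OF K B(1)] by blast
  have len: "length Us = m"
    using Us(3) B(2) \<open>card K > 1\<close> by simp
  have Usc: "set Us \<subseteq> carrier R"
    using independent_in_carrier[OF Us(1)] .
  define \<phi> where "\<phi> f = combine (map f [0..<m]) Us" for f
  let ?C = "{..<m} \<rightarrow>\<^sub>E K"
  have "\<phi> ` ?C = B"
  proof (intro equalityI subsetI)
    fix v assume "v \<in> \<phi> ` ?C"
    then obtain f where f: "f \<in> ?C" "v = \<phi> f" by blast
    have "set (map f [0..<m]) \<subseteq> K"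
      using PiE_mem[OF f(1)] by auto
    moreover have "length (map f [0..<m]) = length Us"
      using len by simp
    ultimately show "v \<in> B"
      unfolding Us(2)[symmetric] Span_mem_iff_length_version[OF K(1) Usc] f(2) \<phi>_def by blast
  next
    fix v assume "v \<in> B"
    then obtain Ks where Ks: "set Ks \<subseteq> K" "length Ks = m" "v = combine Ks Us"
      unfolding Us(2)[symmetric] Span_mem_iff_length_version[OF K(1) Usc] len by blast
    have "map (\<lambda>i\<in>{..<m}. Ks ! i) [0..<m] = Ks"
      by (rule nth_equalityI) (auto simp: Ks(2))
    then have "v = \<phi> (\<lambda>i\<in>{..<m}. Ks ! i)"
      unfolding \<phi>_def Ks(3) by simp
    moreover have "(\<lambda>i\<in>{..<m}. Ks ! i) \<in> ?C"
      using Ks by auto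
    ultimately show "v \<in> \<phi> ` ?C" by blast
  qed
  \<comment> \<open>Injectivity comes by counting: a surjection between finite sets of equal size is
    injective.\<close>
  moreover have "card ?C = card K ^ m"
    by (simp add: card_funcsetE)
  moreover have "finite ?C"
    using K(2) by (simp add: finite_PiE)
  ultimately have "bij_betw \<phi> ?C B"
    using eq_card_imp_inj_on[of ?C \<phi>] B(2) by (simp add: bij_betw_def)
  moreover have "\<phi> (\<lambda>i\<in>{..<m}. a \<otimes> f i \<oplus> b \<otimes> g i) = a \<otimes> \<phi> f \<oplus> b \<otimes> \<phi> g"
    if ab: "a \<in> K" "b \<in> K" and fg: "f \<in> ?C" "g \<in> ?C" for a b f g
  proof -
    have c: "f i \<in> carrier R" "g i \<in> carrier R" if "i < m" for i
      using fg Kc that by auto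
    have ab': "a \<in> carrier R" "b \<in> carrier R"
      using ab Kc by auto
    have "a \<otimes> \<phi> f \<oplus> b \<otimes> \<phi> g = combine (map ((\<otimes>) a) (map f [0..<m])) Us
        \<oplus> combine (map ((\<otimes>) b) (map g [0..<m])) Us"
      unfolding \<phi>_def using c ab' Usc by (subst (1 2) combine_r_distr) auto
    also have "\<dots> = combine (map2 (\<oplus>) (map ((\<otimes>) a) (map f [0..<m])) (map ((\<otimes>) b) (map g [0..<m]))) Us"
      using c ab' Usc len by (intro combine_add) auto
    also have "map2 (\<oplus>) (map ((\<otimes>) a) (map f [0..<m])) (map ((\<otimes>) b) (map g [0..<m]))
        = map (\<lambda>i\<in>{..<m}. a \<otimes> f i \<oplus> b \<otimes> g i) [0..<m]"
      by (rule nth_equalityI) auto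
    finally show ?thesis
      unfolding \<phi>_def by simp
  qed
  ultimately show thesis
    using that by blast
qed

end

section \<open>Stabilizers of finite subspaces, and inverses in a plane\<close>

text \<open>Evaluation at \<open>v\<close> embeds \<open>E\<close> into \<open>V\<close>, so
  \<open>E\<close> is finite. That \<open>V\<close> is a space over \<open>E\<close> is built into
  the choice of \<open>E\<close>.\<close>

lemma (in field) stabilizer_subfield:
  assumes K: "subfield K R" and V: "subalgebra K V R" "finite V" and v: "v \<in> V" "v \<noteq> \<zero>"
  defines "E \<equiv> {y \<in> carrier R. \<forall>z\<in>V. y \<otimes> z \<in> V}"
  shows "finite E" "K \<subseteq> E" "subfield E R" "subalgebra E V R"
proof -
  have Vc: "V \<subseteq> carrier R"
    using subalgebra_in_carrier[OF V(1)] .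
  have Vg: "subgroup V (add_monoid R)"
    using V(1) unfolding subalgebra_def by blast
  have vc: "v \<in> carrier R"
    using v Vc by auto
  have "inj_on (\<lambda>y. y \<otimes> v) E"
    unfolding E_def using vc v(2) by (auto intro!: inj_onI simp: m_rcancel)
  moreover have "(\<lambda>y. y \<otimes> v) ` E \<subseteq> V"
    unfolding E_def using v by auto
  ultimately show fin: "finite E"
    using V(2) finite_subset finite_imageD by metis
  show "K \<subseteq> E"
    unfolding E_def using subfieldE(3)[OF K] subalgebra.smult_closed[OF V(1)] by auto
  have ring: "subring E R"
  proof (rule subringI)
    show "E \<subseteq> carrier R" "\<one> \<in> E"
      unfolding E_def using Vc by auto
    show "\<ominus> h \<in> E" if "h \<in> E" for h
      using that Vc add.subgroupE(3)[OF Vg] unfolding E_def by (auto simp: l_minus)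
    show "h \<otimes> h' \<in> E" if "h \<in> E" "h' \<in> E" for h h'
      using that Vc unfolding E_def by (auto simp: m_assoc)
    show "h \<oplus> h' \<in> E" if "h \<in> E" "h' \<in> E" for h h'
      using that Vc add.subgroupE(4)[OF Vg] unfolding E_def by (auto simp: l_distr subset_iff)
  qed
  show "subfield E R"
  proof (rule subfieldI'[OF ring])
    fix k assume k: "k \<in> E - {\<zero>}"
    then have kc: "k \<in> carrier R" "k \<noteq> \<zero>" "\<forall>z\<in>V. k \<otimes> z \<in> V"
      unfolding E_def by auto
    \<comment> \<open>An injective self-map of the finite set \<open>V\<close> is onto, so every
      element of \<open>V\<close> is \<open>k\<close> times some \<open>z'\<close> in
      \<open>V\<close>, and \<open>inv k\<close> sends it back to \<open>z'\<close>.\<close>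
    have "inj_on ((\<otimes>) k) V"
      using kc Vc by (intro inj_onI) (metis m_lcancel subsetD)
    then have kV: "(\<otimes>) k ` V = V"
      using kc(3) V(2) by (intro endo_inj_surj) auto
    have unit: "k \<in> Units R"
      using kc(1,2) field_Units by simp
    have "inv k \<otimes> z \<in> V" if "z \<in> V" for z
    proof -
      have "z \<in> (\<otimes>) k ` V"
        using kV that by simp
      then obtain z' where z': "z' \<in> V" "z = k \<otimes> z'"
        by (rule imageE)
      then have "inv k \<otimes> z = (inv k \<otimes> k) \<otimes> z'"
        using unit kc(1) subsetD[OF Vc z'(1)] Units_inv_closed[OF unit] by (simp only: m_assoc)
      then show ?thesis
        using z'(1) unit subsetD[OF Vc z'(1)] by simp
    qed
    then show "inv k \<in> E"
      unfolding E_def using unit by simp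
  qed
  show "subalgebra E V R"
    using Vg unfolding subalgebra_def subalgebra_axioms_def E_def by auto
qed

text \<open>\<open>W\<close> stands for representatives of distinct points on one line: by
  \<open>indep\<close>, different members are never proportional. \<open>U\<close> is the vector
  plane over that line; an upper bound on its size is enough, since two members of \<open>W\<close>
  then generate it.\<close>

lemma (in field) card_inverses_in_plane_le:
  assumes K: "subfield K R" "finite K"
    and A: "subalgebra K A R" "card A = card K ^ d"
    and noE: "\<And>e E W. \<lbrakk>e > 1; subfield E R; card E = card K ^ e; subalgebra E W R; W \<subseteq> A\<rbrakk>
           \<Longrightarrow> W = {\<zero>}"
    and U: "subalgebra K U R" "finite U" "card U \<le> card K ^ 2"
    and W: "W \<subseteq> U - {\<zero>}" "m_inv R ` W \<subseteq> A"
    and indep: "\<And>w w' k. \<lbrakk>w \<in> W; w' \<in> W; k \<in> K; w = k \<otimes> w'\<rbrakk> \<Longrightarrow> w = w'"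
  shows "card W \<le> d"
proof (rule ccontr)
  assume "\<not> card W \<le> d"
  have Kc: "K \<subseteq> carrier R"
    using subfieldE(3)[OF K(1)] .
  have q: "card K > 1"
    using card_subfield_gt_1[OF K] .
  have finA: "finite A"
    using A(2) q by (intro card_ge_0_finite) auto
  have Wc: "W \<subseteq> carrier R - {\<zero>}"
    using W(1) subalgebra_in_carrier[OF U(1)] by auto
  have inv: "inv w \<in> carrier R" "inv w \<noteq> \<zero>" "w \<otimes> inv w = \<one>" "w \<in> carrier R" if "w \<in> W" for w
  proof -
    have "w \<in> Units R"
      using that Wc field_Units by auto
    then show "inv w \<in> carrier R" "w \<otimes> inv w = \<one>" "w \<in> carrier R" "inv w \<noteq> \<zero>"
      using Units_inv_Units[of w] field_Units by auto
  qed
  obtain ws where ws: "set ws = W" "distinct ws"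
    using finite_distinct_list[of W] finite_subset[OF W(1)] U(2) by auto
  let ?us = "map (m_inv R) ws"
  have us: "set ?us \<subseteq> A" "set ?us \<subseteq> carrier R"
    using ws W(2) inv by auto
  \<comment> \<open>Independent inverses would span \<open>card K ^ card W\<close> elements inside
    \<open>A\<close>, which has only \<open>card K ^ d\<close>.\<close>
  have "dependent K ?us"
  proof
    assume "independent K ?us"
    then have "card K ^ length ws = card (Span K ?us)"
      using card_Span_independent[OF K] by simp
    also have "\<dots> \<le> card K ^ d"
      using card_mono[OF finA subalgebra_Span_incl[OF K(1) A(1) us(1)]] A(2) by simp
    finally have "length ws \<le> d"
      using q by simp
    then show False
      using \<open>\<not> card W \<le> d\<close> ws distinct_card by metis
  qed
  then obtain xs u ys where split: "?us = xs @ u # ys" "u \<in> Span K ys"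
    using dependent_split[OF us(2)] by blast
  then obtain ws' w0 zs where zs: "ws = ws' @ w0 # zs" "u = inv w0" "ys = map (m_inv R) zs"
    by (auto simp: map_eq_append_conv map_eq_Cons_conv)
  have w0: "w0 \<in> W" "w0 \<notin> set zs" and zsW: "set zs \<subseteq> W"
    using ws zs(1) by auto
  \<comment> \<open>An empty \<open>zs\<close> would put the nonzero \<open>inv w0\<close> into the
    zero space.\<close>
  have "zs \<noteq> []"
    using split(2) zs inv(2)[OF w0(1)] by auto
  then obtain w1 where w1: "w1 \<in> set zs"
    by (cases zs) auto
  then have w1W: "w1 \<in> W" and w01: "w1 \<noteq> w0"
    using zsW w0(2) by auto
  define V where "V = Span K ys"
  have ysc: "set ys \<subseteq> carrier R" "set ys \<subseteq> A"
    using us split by auto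
  have V: "subalgebra K V R" "finite V" "V \<subseteq> A" "inv w0 \<in> V"
    unfolding V_def using Span_is_subalgebra[OF K(1) ysc(1)] finite_Span[OF K ysc(1)]
      subalgebra_Span_incl[OF K(1) A(1) ysc(2)] split(2) zs(2) by auto
  have Vg: "subgroup V (add_monoid R)"
    using V(1) unfolding subalgebra_def by blast
  have ysV: "inv w \<in> V" if "w \<in> set zs" for w
    using Span_base_incl[OF K(1) ysc(1)] that unfolding V_def zs(3) by auto
  \<comment> \<open>Being non-proportional, \<open>w0\<close> and \<open>w1\<close> span
    \<open>card K ^ 2\<close> elements, which exhausts \<open>U\<close>.\<close>
  have "Span K [w0, w1] = U"
  proof (rule card_seteq[OF U(2)])
    show "Span K [w0, w1] \<subseteq> U"
      using w0(1) w1W W(1) by (intro subalgebra_Span_incl[OF K(1) U(1)]) auto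
    have "w0 \<notin> Span K [w1]"
    proof
      assume "w0 \<in> Span K [w1]"
      then obtain k where k: "k \<in> K" "w0 = k \<otimes> w1 \<oplus> \<zero>"
        by (auto simp: line_extension_mem_iff)
      then have "w0 = k \<otimes> w1"
        using inv(4)[OF w1W] subsetD[OF Kc k(1)] by simp
      then show False
        using indep[OF w0(1) w1W k(1)] w01 by simp
    qed
    moreover have "w1 \<notin> Span K []"
      using w1W W(1) by auto
    ultimately have "independent K [w0, w1]"
      using inv(4) w0(1) w1W by (auto intro!: li_Cons simp del: Span.simps)
    then show "card U \<le> card (Span K [w0, w1])"
      using card_Span_independent[OF K] U(3) by (simp del: Span.simps add: numeral_2_eq_2)
  qed
  then have U_eq: "U = {a \<otimes> w0 \<oplus> b \<otimes> w1 | a b. a \<in> K \<and> b \<in> K}"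
    using Span_pair[OF K(1)] inv(4) w0(1) w1W by simp
  define x where "x = w1 \<otimes> inv w0"
  have xc: "x \<in> carrier R"
    unfolding x_def using inv w0(1) w1W by simp
  text \<open>If \<open>w = a w\<^sub>0 + b w\<^sub>1\<close>, then \<open>x / w = (1 / w\<^sub>0 - a / w) / b\<close>.\<close>
  have x_ys: "x \<otimes> inv w \<in> V" if w: "w \<in> set zs" for w
  proof -
    have wW: "w \<in> W"
      using w zsW by auto
    then obtain a b where ab: "a \<in> K" "b \<in> K" "w = a \<otimes> w0 \<oplus> b \<otimes> w1"
      using W(1) U_eq by blast
    note c = inv(1,4)[OF wW] inv(1,4)[OF w0(1)] inv(1,4)[OF w1W]
    have abc: "a \<in> carrier R" "b \<in> carrier R"
      using ab Kc by auto
    \<comment> \<open>Otherwise \<open>w\<close> would be a multiple of \<open>w0\<close>, hence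
      equal to it, but \<open>w0\<close> does not occur in \<open>zs\<close>.\<close>
    have "b \<noteq> \<zero>"
      using indep[OF wW w0(1) ab(1)] ab(3) abc c w w0(2) by auto
    have "b \<otimes> (x \<otimes> inv w) = (b \<otimes> w1) \<otimes> (inv w0 \<otimes> inv w)"
      unfolding x_def using abc c by algebra
    also have "b \<otimes> w1 = w \<ominus> a \<otimes> w0"
      unfolding ab(3) using abc c by algebra
    also have "(w \<ominus> a \<otimes> w0) \<otimes> (inv w0 \<otimes> inv w)
        = (w \<otimes> inv w) \<otimes> inv w0 \<oplus> (\<ominus> a) \<otimes> ((w0 \<otimes> inv w0) \<otimes> inv w)"
      using abc c by algebra
    also have "\<dots> = inv w0 \<oplus> (\<ominus> a) \<otimes> inv w"
      using inv(3)[OF wW] inv(3)[OF w0(1)] c by simp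
    also have "\<dots> \<in> V"
      using add.subgroupE(4)[OF Vg V(4)] subalgebra.smult_closed[OF V(1) _ ysV[OF w]]
        subringE(5)[OF subfieldE(1)[OF K(1)] ab(1)] by auto
    finally show ?thesis
      unfolding V_def using Span_m_inv_simprule[OF K(1) ysc(1), of b] ab(2) \<open>b \<noteq> \<zero>\<close> xc c by auto
  qed
  \<comment> \<open>Multiplication by \<open>x\<close> commutes with linear combinations, so its
    effect on the generators \<open>ys\<close> decides.\<close>
  have xV: "x \<otimes> z \<in> V" if z: "z \<in> V" for z
  proof -
    obtain Ks where Ks: "set Ks \<subseteq> K" "z = combine Ks ys"
      using z[unfolded V_def Span_eq_combine_set[OF K(1) ysc(1)]] by blast
    have "x \<otimes> z = combine Ks (map (\<lambda>y. y \<otimes> x) ys)"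
      using combine_l_distr[of Ks ys x] Ks Kc xc ysc(1) m_comm[of x z] combine_in_carrier[of Ks ys]
      by auto
    moreover have "set (map (\<lambda>y. y \<otimes> x) ys) \<subseteq> V"
      using x_ys xc ysc(1) zs(3) zsW inv(1) by (auto simp: m_comm subset_iff)
    ultimately show ?thesis
      using subalgebra_Span_incl[OF K(1) V(1), of "map (\<lambda>y. y \<otimes> x) ys"]
        Span_eq_combine_set[OF K(1), of "map (\<lambda>y. y \<otimes> x) ys"] Ks(1) subalgebra_in_carrier[OF V(1)]
      by blast
  qed
  define E where "E = {y \<in> carrier R. \<forall>z\<in>V. y \<otimes> z \<in> V}"
  note E = stabilizer_subfield[OF K(1) V(1,2,4) inv(2)[OF w0(1)], folded E_def]
  \<comment> \<open>Viewing \<open>E\<close> as a space over \<open>K\<close> makes its size a power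
    of \<open>card K\<close>, as \<open>noE\<close> demands. The proper inclusion of
    \<open>K\<close> in \<open>E\<close> then forces the exponent above 1.\<close>
  have "subalgebra K E R"
    using E(2) subring.axioms(1)[OF subfieldE(1)[OF E(3)]] subringE(6)[OF subfieldE(1)[OF E(3)]]
    unfolding subalgebra_def subalgebra_axioms_def by auto
  then obtain e where e: "card E = card K ^ e"
    using finite_subalgebra_base[OF K _ E(1)] by metis
  have "x \<notin> K"
  proof
    assume "x \<in> K"
    moreover have "w1 = x \<otimes> w0"
    proof -
      have "x \<otimes> w0 = w1 \<otimes> (w0 \<otimes> inv w0)"
        unfolding x_def using inv(1,4)[OF w0(1)] inv(4)[OF w1W] by algebra
      then show ?thesis
        using inv(3)[OF w0(1)] inv(4)[OF w1W] by simp
    qed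
    ultimately show False
      using indep[OF w1W w0(1)] w01 by blast
  qed
  then have "K \<subset> E"
  proof -
    have "x \<in> E"
      unfolding E_def using xc xV by simp
    then show "K \<subset> E"
      using E(2) \<open>x \<notin> K\<close> by blast
  qed
  then have "card K ^ 1 < card K ^ e"
    using psubset_card_mono[OF E(1)] e by simp
  then have "e > 1"
    using q power_strict_increasing_iff[of "card K" 1] by simp
  then have "V = {\<zero>}"
    using noE[OF _ E(3) e E(4) V(3)] by blast
  then show False
    using V(4) inv(2)[OF w0(1)] by simp
qed

section \<open>From field elements to caps\<close>

text \<open>Multiplication by \<open>k\<close> permutes \<open>K\<close>, so passing to a nonzero
  multiple of a vector only reindexes the scalars.\<close>

lemma (in field) span1_smult:
  assumes K: "subfield K R" and k: "k \<in> K" "k \<noteq> \<zero>" and u: "u \<in> {..<m} \<rightarrow>\<^sub>E K"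
  shows "span1 (R\<lparr>carrier := K\<rparr>) m (\<lambda>i\<in>{..<m}. k \<otimes> u i) = span1 (R\<lparr>carrier := K\<rparr>) m u"
proof -
  have inv: "inv k \<in> K" "inv k \<otimes> k = \<one>"
    using subfield_m_inv[OF K, of k] k by auto
  have c: "x \<in> carrier R" if "x \<in> K" for x
    using subfieldE(3)[OF K] that by auto
  have mult: "a \<otimes> b \<in> K" if "a \<in> K" "b \<in> K" for a b
    using subringE(6)[OF subfieldE(1)[OF K]] that .
  have uK: "u i \<in> K" if "i \<in> {..<m}" for i
    using PiE_mem[OF u that] .
  have "(\<lambda>i\<in>{..<m}. a \<otimes> (\<lambda>i\<in>{..<m}. k \<otimes> u i) i) = (\<lambda>i\<in>{..<m}. (a \<otimes> k) \<otimes> u i)"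
    if "a \<in> K" for a
    using c[OF that] c[OF k(1)] c[OF uK] by (intro restrict_ext) (simp add: m_assoc)
  then have "span1 (R\<lparr>carrier := K\<rparr>) m (\<lambda>i\<in>{..<m}. k \<otimes> u i)
      = (\<lambda>a. \<lambda>i\<in>{..<m}. a \<otimes> u i) ` (\<lambda>a. a \<otimes> k) ` K"
    unfolding span1_def by (simp add: Setcompr_eq_image image_image)
  moreover have "(\<lambda>a. a \<otimes> k) ` K = K"
  proof (intro equalityI subsetI)
    fix a assume a: "a \<in> K"
    then have "a = (a \<otimes> inv k) \<otimes> k"
      using inv c k(1) by (simp add: m_assoc)
    then show "a \<in> (\<lambda>a. a \<otimes> k) ` K"
      using mult[OF a inv(1)] by blast
  qed (use mult k(1) in auto)
  ultimately show ?thesis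
    unfolding span1_def by (simp add: Setcompr_eq_image)
qed

text \<open>\<open>Max\<close> is informative only on a finite set; here the number of points bounds
  all cap sizes.\<close>

lemma is_cap_le_max_cap:
  assumes "is_cap F n k r S" "finite (carrier F)"
  shows "k \<le> max_cap r n F"
proof -
  have "finite (PG_points F n)"
  proof (rule finite_subset)
    show "PG_points F n \<subseteq> span1 F (n + 1) ` coord_space F (n + 1)"
      unfolding PG_points_def nonzero_vecs_def by blast
    show "finite (span1 F (n + 1) ` coord_space F (n + 1))"
      unfolding coord_space_def using assms(2) by (simp add: finite_PiE)
  qed
  then have "{k. \<exists>S. is_cap F n k r S} \<subseteq> {..card (PG_points F n)}"
    unfolding is_cap_def by (auto intro: card_mono)
  then have "finite {k. \<exists>S. is_cap F n k r S}"
    using finite_subset by blast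
  then show ?thesis
    unfolding max_cap_def using assms(1) by (intro Max_ge) auto
qed

lemma (in field) inverse_setD:
  assumes A: "subalgebra K A R" and x: "x \<in> inverse_set R A"
  shows "x \<in> carrier R" "x \<noteq> \<zero>" "inv x \<in> A"
proof -
  obtain y where y: "y \<in> A" "y \<noteq> \<zero>" "x = inv y"
    using x unfolding inverse_set_def by blast
  then have "y \<in> Units R"
    using subalgebra_in_carrier[OF A] field_Units by auto
  then have "inv x = y" "x \<in> Units R"
    using y(3) Units_inv_inv[of y] Units_inv_Units[of y] by simp_all
  then show "x \<in> carrier R" "x \<noteq> \<zero>" "inv x \<in> A"
    using y(1) field_Units by auto
qed

text \<open>The points represented by \<open>inverse_set R A \<inter> B\<close> form a cap by the
  plane bound, and each carries at most \<open>card K - 1\<close> nonzero elements. The exponent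
  \<open>n + 1\<close> matches the coordinate space behind \<open>PG_points\<close> in projective
  dimension \<open>n\<close>.\<close>

lemma (in field) card_inverse_set_inter_le:
  assumes K: "subfield K R" "finite K"
    and A: "subalgebra K A R" "card A = card K ^ d"
    and B: "subalgebra K B R" "card B = card K ^ (n + 1)"
    and noE: "\<And>e E W. \<lbrakk>e > 1; subfield E R; card E = card K ^ e; subalgebra E W R; W \<subseteq> A\<rbrakk>
           \<Longrightarrow> W = {\<zero>}"
  shows "card (inverse_set R A \<inter> B) \<le> max_cap d n (R\<lparr>carrier := K\<rparr>) * (card K - 1)"
proof -
  let ?F = "R\<lparr>carrier := K\<rparr>" and ?m = "n + 1"
  let ?C = "{..<?m} \<rightarrow>\<^sub>E K"
  let ?X = "inverse_set R A \<inter> B"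
  have Kc: "K \<subseteq> carrier R"
    using subfieldE(3)[OF K(1)] .
  have zK: "\<zero> \<in> K" and oK: "\<one> \<in> K"
    using subringE(2,3)[OF subfieldE(1)[OF K(1)]] by auto
  have Bc: "B \<subseteq> carrier R"
    using subalgebra_in_carrier[OF B(1)] .
  obtain \<phi> where bij: "bij_betw \<phi> ?C B"
    and lin: "\<And>a b f g. \<lbrakk>a \<in> K; b \<in> K; f \<in> ?C; g \<in> ?C\<rbrakk> \<Longrightarrow>
      \<phi> (\<lambda>i\<in>{..<?m}. a \<otimes> f i \<oplus> b \<otimes> g i) = a \<otimes> \<phi> f \<oplus> b \<otimes> \<phi> g"
    using subalgebra_coordinates[OF K B] by blast
  have inj: "inj_on \<phi> ?C" and \<phi>B: "\<phi> f \<in> B" "\<phi> f \<in> carrier R" if "f \<in> ?C" for f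
    using bij bij_betw_apply[OF bij that] Bc by (auto simp: bij_betw_def)
  have Cc: "f i \<in> carrier R" if "f \<in> ?C" "i \<in> {..<?m}" for f i
    using PiE_mem[OF that] Kc by auto
  \<comment> \<open>Scaling is the case of \<open>lin\<close> with second coefficient
    \<open>\<zero>\<close> and \<open>f\<close> in both places.\<close>
  have smult: "\<phi> (\<lambda>i\<in>{..<?m}. a \<otimes> f i) = a \<otimes> \<phi> f" if "a \<in> K" "f \<in> ?C" for a f
  proof -
    have "(\<lambda>i\<in>{..<?m}. a \<otimes> f i \<oplus> \<zero> \<otimes> f i) = (\<lambda>i\<in>{..<?m}. a \<otimes> f i)"
      using Cc[OF that(2)] subsetD[OF Kc that(1)] by (intro restrict_ext) simp
    then show ?thesis
      using lin[OF that(1) zK that(2) that(2)] \<phi>B(2)[OF that(2)] subsetD[OF Kc that(1)] by simp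
  qed
  have smultC: "(\<lambda>i\<in>{..<?m}. a \<otimes> f i) \<in> ?C" if "a \<in> K" "f \<in> ?C" for a f
    using subringE(6)[OF subfieldE(1)[OF K(1)] that(1)] PiE_mem[OF that(2)]
    by (simp add: restrict_PiE_iff)
  \<comment> \<open>The zero vector is its own zero multiple, so \<open>\<phi>\<close> sends it to
    \<open>\<zero>\<close>.\<close>
  have nz: "u \<in> nonzero_vecs ?F ?m" if u: "u \<in> ?C" "\<phi> u \<noteq> \<zero>" for u
  proof -
    have "u \<noteq> (\<lambda>i\<in>{..<?m}. \<zero>)"
    proof
      assume eq: "u = (\<lambda>i\<in>{..<?m}. \<zero>)"
      have "(\<lambda>i\<in>{..<?m}. \<zero> \<otimes> u i) = (\<lambda>i\<in>{..<?m}. \<zero>)"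
        using Cc[OF u(1)] by (intro restrict_ext) simp
      then have "u = (\<lambda>i\<in>{..<?m}. \<zero> \<otimes> u i)"
        using eq by simp
      then have "\<phi> u = \<zero> \<otimes> \<phi> u"
        using smult[OF zK u(1)] by simp
      then show False
        using u \<phi>B(2)[OF u(1)] by simp
    qed
    then show ?thesis
      unfolding nonzero_vecs_def coord_space_def using u(1) by simp
  qed
  have X: "x \<in> B" "x \<in> carrier R" "x \<noteq> \<zero>" "inv x \<in> A" if "x \<in> ?X" for x
    using inverse_setD[OF A(1), of x] that by auto
  define S where "S = {span1 ?F ?m u | u. u \<in> ?C \<and> \<phi> u \<in> ?X}"
  have finC: "finite ?C"
    using K(2) by (simp add: finite_PiE)
  have finS: "finite S"
    unfolding S_def using finC by (simp add: Setcompr_eq_image)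
  \<comment> \<open>\<open>\<phi>\<close> carries \<open>l\<close> into the span \<open>U\<close> of
    two elements. Choosing one vector \<open>r P\<close> for each point \<open>P\<close> of
    \<open>S\<close> on \<open>l\<close> turns the count of points into the plane bound.\<close>
  have "card {P \<in> S. P \<subseteq> l} \<le> d" if l: "l \<in> PG_lines ?F n" for l
  proof -
    let ?T = "{P \<in> S. P \<subseteq> l}"
    obtain u v where uv: "u \<in> ?C" "v \<in> ?C" "l = span2 ?F ?m u v"
      using l unfolding PG_lines_def nonzero_vecs_def coord_space_def by auto
    define U where "U = Span K [\<phi> u, \<phi> v]"
    have Us: "set [\<phi> u, \<phi> v] \<subseteq> carrier R"
      using \<phi>B(2)[OF uv(1)] \<phi>B(2)[OF uv(2)] by simp
    have U: "subalgebra K U R" "finite U" "card U \<le> card K ^ 2"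
      unfolding U_def using Span_is_subalgebra[OF K(1) Us] finite_Span[OF K Us] card_Span_le[OF K Us]
      by (simp_all del: Span.simps add: numeral_2_eq_2)
    have lU: "\<phi> w \<in> U" if wl: "w \<in> l" for w
    proof -
      obtain a b where ab: "a \<in> K" "b \<in> K" "w = (\<lambda>i\<in>{..<?m}. a \<otimes> u i \<oplus> b \<otimes> v i)"
        using wl[unfolded uv(3) span2_def] by (simp del: restrict_apply) blast
      then have "\<phi> w = a \<otimes> \<phi> u \<oplus> b \<otimes> \<phi> v"
        using lin uv(1,2) by simp
      then show ?thesis
        unfolding U_def Span_pair[OF K(1) \<phi>B(2)[OF uv(1)] \<phi>B(2)[OF uv(2)]] using ab(1,2) by blast
    qed
    have "\<forall>P\<in>?T. \<exists>r. r \<in> ?C \<and> \<phi> r \<in> ?X \<and> P = span1 ?F ?m r"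
      unfolding S_def by blast
    then obtain r where r: "\<And>P. P \<in> ?T \<Longrightarrow> r P \<in> ?C \<and> \<phi> (r P) \<in> ?X \<and> P = span1 ?F ?m (r P)"
      by (metis (no_types, lifting))
    have rl: "r P \<in> l" if "P \<in> ?T" for P
    proof -
      have rC: "r P \<in> ?C"
        using r[OF that] by blast
      have "(\<lambda>i\<in>{..<?m}. \<one> \<otimes> r P i) = restrict (r P) {..<?m}"
        using Cc[OF rC] by (intro restrict_ext) simp
      also have "\<dots> = r P"
        using rC by (rule PiE_restrict)
      finally have "r P \<in> span1 ?F ?m (r P)"
        unfolding span1_def using oK by (simp del: restrict_apply) metis
      then show ?thesis
        using r[OF that] that by blast
    qed
    define W where "W = (\<lambda>P. \<phi> (r P)) ` ?T"
    have "inj_on (\<lambda>P. \<phi> (r P)) ?T"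
      using r inj_onD[OF inj] by (intro inj_onI) metis
    then have "card ?T = card W"
      unfolding W_def by (rule card_image[symmetric])
    also have "card W \<le> d"
    proof (rule card_inverses_in_plane_le[OF K A noE U])
      have "\<phi> (r P) \<in> U - {\<zero>}" "inv \<phi> (r P) \<in> A" if "P \<in> ?T" for P
        using lU[OF rl[OF that]] X(3,4)[of "\<phi> (r P)"] r[OF that] by simp_all
      then show "W \<subseteq> U - {\<zero>}" "m_inv R ` W \<subseteq> A"
        unfolding W_def image_image by (simp_all only: image_subset_iff) blast+
      \<comment> \<open>Proportional representatives span the same point, and \<open>r\<close> picks
        only one vector per point.\<close>
      fix w w' k assume w: "w \<in> W" "w' \<in> W" "k \<in> K" "w = k \<otimes> w'"
      obtain P Q where P: "P \<in> ?T" "w = \<phi> (r P)" and Q: "Q \<in> ?T" "w' = \<phi> (r Q)"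
        using w(1,2) unfolding W_def by blast
      have "k \<noteq> \<zero>"
        using w(4) P Q X(3)[of w] X(2)[of w'] r[OF P(1)] r[OF Q(1)] by auto
      have "\<phi> (r P) = \<phi> (\<lambda>i\<in>{..<?m}. k \<otimes> r Q i)"
        using smult[OF w(3)] r[OF Q(1)] w(4) P(2) Q(2) by simp
      then have "r P = (\<lambda>i\<in>{..<?m}. k \<otimes> r Q i)"
        using inj_onD[OF inj] r[OF P(1)] r[OF Q(1)] smultC[OF w(3)] by blast
      then have "P = Q"
        using span1_smult[OF K(1) w(3) \<open>k \<noteq> \<zero>\<close>] r[OF P(1)] r[OF Q(1)] by metis
      then show "w = w'"
        using P(2) Q(2) by simp
    qed auto
    finally show ?thesis .
  qed
  moreover have "S \<subseteq> PG_points ?F n"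
    unfolding S_def PG_points_def using nz X(3) by blast
  ultimately have "is_cap ?F n (card S) d S"
    unfolding is_cap_def using finS by blast
  then have cap: "card S \<le> max_cap d n ?F"
    using is_cap_le_max_cap[of ?F] K(2) by simp
  \<comment> \<open>Each \<open>x\<close> is the image of a vector lying in the point that this
    vector spans. Removing \<open>\<zero>\<close> from each image yields the factor
    \<open>card K - 1\<close> instead of \<open>card K\<close>.\<close>
  have "?X \<subseteq> (\<Union>P\<in>S. \<phi> ` P - {\<zero>})"
  proof
    fix x assume x: "x \<in> ?X"
    then obtain u where u: "u \<in> ?C" "x = \<phi> u"
      using X(1)[OF x] bij unfolding bij_betw_def by blast
    have "(\<lambda>i\<in>{..<?m}. \<one> \<otimes> u i) = restrict u {..<?m}"
      using Cc[OF u(1)] by (intro restrict_ext) simp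
    also have "\<dots> = u"
      using u(1) by (rule PiE_restrict)
    finally have "u \<in> span1 ?F ?m u"
      unfolding span1_def using oK by (simp del: restrict_apply) metis
    then show "x \<in> (\<Union>P\<in>S. \<phi> ` P - {\<zero>})"
      unfolding S_def using u x X(3)[OF x] by blast
  qed
  moreover have fin1: "finite P" and card1: "card (\<phi> ` P - {\<zero>}) \<le> card K - 1" if PS: "P \<in> S" for P
  proof -
    obtain u where u: "u \<in> ?C" "P = span1 ?F ?m u"
      using PS unfolding S_def by blast
    have P: "P = (\<lambda>a. \<lambda>i\<in>{..<?m}. a \<otimes> u i) ` K"
      unfolding u(2) span1_def by (simp add: Setcompr_eq_image)
    then show "finite P"
      using K(2) by simp
    have "\<phi> ` P = (\<lambda>a. a \<otimes> \<phi> u) ` K"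
      unfolding P image_image using smult[OF _ u(1)] by (intro image_cong) auto
    then have "\<phi> ` P - {\<zero>} \<subseteq> (\<lambda>a. a \<otimes> \<phi> u) ` (K - {\<zero>})"
      using \<phi>B(2)[OF u(1)] by auto
    then have "card (\<phi> ` P - {\<zero>}) \<le> card (K - {\<zero>})"
      using K(2) by (meson card_image_le card_mono finite_Diff finite_imageI order_trans)
    then show "card (\<phi> ` P - {\<zero>}) \<le> card K - 1"
      using zK by simp
  qed
  ultimately have "card ?X \<le> card (\<Union>P\<in>S. \<phi> ` P - {\<zero>})"
    using finS by (intro card_mono) auto
  also have "\<dots> \<le> (\<Sum>P\<in>S. card (\<phi> ` P - {\<zero>}))"
    by (rule card_UN_le[OF finS])
  also have "\<dots> \<le> card S * (card K - 1)"
    using sum_bounded_above[of S "\<lambda>P. card (\<phi> ` P - {\<zero>})" "card K - 1"] card1 by simp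
  also have "\<dots> \<le> max_cap d n ?F * (card K - 1)"
    using cap by simp
  finally show ?thesis .
qed

theorem theorem3:
  fixes L :: "('a, 'b) ring_scheme" (structure)
    and K A B :: "'a set"
    and q d d' :: nat
  assumes "primepow q"
    and "algebraic_closure L K" and "card K = q"
    and "subalgebra K A L" and "card A = q ^ d"
    and "subalgebra K B L" and "card B = q ^ d'"
    and "\<And>e E W. \<lbrakk>e > 1; subfield E L; card E = q ^ e; subalgebra E W L; W \<subseteq> A\<rbrakk>
           \<Longrightarrow> W = {\<zero>}"
  shows "real (card (inverse_set L A \<inter> B)) / (real q - 1)
           \<le> real (max_cap d (d' - 1) (L\<lparr>carrier := K\<rparr>))"
proof -
  interpret algebraic_closure L K
    by (rule assms(2))
  have K: "subfield K L"
    by (rule subfield_axioms)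
  have q: "q > 1"
    using assms(1) primepow_gt_Suc_0 by simp
  then have finK: "finite K"
    using assms(3) by (intro card_ge_0_finite) auto
  let ?X = "inverse_set L A \<inter> B" and ?M = "max_cap d (d' - 1) (L\<lparr>carrier := K\<rparr>)"
  have "card ?X \<le> ?M * (q - 1)"
  proof (cases d')
    \<comment> \<open>Here \<open>d' - 1\<close> is truncated to \<open>0\<close>, so the coordinate
      argument does not apply; but \<open>B\<close> is the zero space and contains no
      inverse.\<close>
    case 0
    then have "card B = 1"
      using assms(7) by simp
    moreover have "\<zero> \<in> B"
      using assms(6) unfolding subalgebra_def by (auto dest: subgroup.one_closed)
    ultimately have "B = {\<zero>}"
      by (auto simp: card_1_singleton_iff)
    then have "?X = {}"
      using inverse_setD(2)[OF assms(4)] by auto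
    then show ?thesis by simp
  next
    case (Suc n)
    then show ?thesis
      using card_inverse_set_inter_le[OF K finK assms(4), of d B n] assms(3,5-8) by simp
  qed
  then have "real (card ?X) \<le> real (?M * (q - 1))"
    by (rule of_nat_mono)
  \<comment> \<open>By \<open>q > 1\<close> the truncated difference \<open>q - 1\<close> agrees
    with the real one, which is positive and may be divided by.\<close>
  also have "\<dots> = real ?M * (real q - 1)"
    using q by (simp add: of_nat_diff)
  finally show ?thesis
    using q by (simp add: pos_divide_le_eq)
qed

end
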